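(* Let $C$ be a $k$-vector space equipped with $n$ linear maps $\Delta_0,\dots,\Delta_{n-1}:C\to C^{\otimes 2}$ such that $$(\Delta_i\otimes id)\Delta_j=(id\otimes\Delta_j)\Delta_i,\qquad i,j=0,\dots,n-1.$$ Let $Z=(Z_{ij})_{0\le i,j\le n-1}\in M_n(k)$ be an $n\times n$ matrix and set $\Delta'_i:=\sum_{j=0}^{n-1}Z_{ij}\Delta_j$ for $i=0,\dots,n-1$. Then $$(\Delta'_i\otimes id)\Delta'_j=(id\otimes\Delta'_j)\Delta'_i,\qquad i,j=0,\dots,n-1.$$
   Context: The field $k$ is $\mathbb{R}$ or $\mathbb{C}$. $M_n(k)$ denotes the $n\times n$ matrices over $k$. *)

theory Defs
  imports
    "Jordan_Normal_Form.VS_Connect"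
    "HOL-Algebra.Free_Abelian_Groups"
    "HOL-Algebra.QuotRing"
begin

text \<open>The tensor product of two modules \<open>V\<close> and \<open>W\<close> over a commutative ring \<open>K\<close> is constructed as
  the free abelian group on \<open>carrier V \<times> carrier W\<close> modulo the subgroup generated by the relations
  expressing that \<open>(v, w) \<mapsto> v \<otimes> w\<close> is biadditive and \<open>K\<close>-balanced.\<close>

definition tensor_relators ::
    "('k, 'r) ring_scheme \<Rightarrow> ('k, 'v, 'm) module_scheme \<Rightarrow> ('k, 'w, 'n) module_scheme
      \<Rightarrow> ('v \<times> 'w \<Rightarrow>\<^sub>0 int) set" where
  "tensor_relators K V W =
     {frag_of (v \<oplus>\<^bsub>V\<^esub> v', w) - frag_of (v, w) - frag_of (v', w) | v v' w.
        v \<in> carrier V \<and> v' \<in> carrier V \<and> w \<in> carrier W}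
   \<union> {frag_of (v, w \<oplus>\<^bsub>W\<^esub> w') - frag_of (v, w) - frag_of (v, w') | v w w'.
        v \<in> carrier V \<and> w \<in> carrier W \<and> w' \<in> carrier W}
   \<union> {frag_of (a \<odot>\<^bsub>V\<^esub> v, w) - frag_of (v, a \<odot>\<^bsub>W\<^esub> w) | a v w.
        a \<in> carrier K \<and> v \<in> carrier V \<and> w \<in> carrier W}"

definition tensor_null ::
    "('k, 'r) ring_scheme \<Rightarrow> ('k, 'v, 'm) module_scheme \<Rightarrow> ('k, 'w, 'n) module_scheme
      \<Rightarrow> ('v \<times> 'w \<Rightarrow>\<^sub>0 int) set" where
  "tensor_null K V W =
     generate (free_Abelian_group (carrier V \<times> carrier W)) (tensor_relators K V W)"

definition tensor_class ::
    "('k, 'r) ring_scheme \<Rightarrow> ('k, 'v, 'm) module_scheme \<Rightarrow> ('k, 'w, 'n) module_scheme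
      \<Rightarrow> ('v \<times> 'w \<Rightarrow>\<^sub>0 int) \<Rightarrow> ('v \<times> 'w \<Rightarrow>\<^sub>0 int) set" where
  "tensor_class K V W x =
     tensor_null K V W #>\<^bsub>free_Abelian_group (carrier V \<times> carrier W)\<^esub> x"

text \<open>The ring components \<open>mult\<close> and \<open>one\<close> of the record play no role for modules.  Scalars act by
  \<open>a \<odot> [\<Sum>i. (v\<^sub>i, w\<^sub>i)] = [\<Sum>i. (a \<odot> v\<^sub>i, w\<^sub>i)]\<close>; the union runs over all representatives of the
  class \<open>X\<close>.\<close>

definition tensor_product ::
    "('k, 'r) ring_scheme \<Rightarrow> ('k, 'v, 'm) module_scheme \<Rightarrow> ('k, 'w, 'n) module_scheme
      \<Rightarrow> ('k, ('v \<times> 'w \<Rightarrow>\<^sub>0 int) set) module" where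
  "tensor_product K V W =
     (let Q = free_Abelian_group (carrier V \<times> carrier W) Mod tensor_null K V W in
      \<lparr>carrier = carrier Q, mult = undefined, one = undefined,
       ring.zero = \<one>\<^bsub>Q\<^esub>, ring.add = (\<otimes>\<^bsub>Q\<^esub>),
       smult = (\<lambda>a X. \<Union>x\<in>X. tensor_class K V W
                        (frag_extend (\<lambda>(v, w). frag_of (a \<odot>\<^bsub>V\<^esub> v, w)) x))\<rparr>)"

definition tensor ::
    "('k, 'r) ring_scheme \<Rightarrow> ('k, 'v, 'm) module_scheme \<Rightarrow> ('k, 'w, 'n) module_scheme
      \<Rightarrow> 'v \<Rightarrow> 'w \<Rightarrow> ('v \<times> 'w \<Rightarrow>\<^sub>0 int) set" where
  "tensor K V W v w = tensor_class K V W (frag_of (v, w))"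

definition bilinear_map ::
    "('k, 'r) ring_scheme \<Rightarrow> ('k, 'v, 'm) module_scheme \<Rightarrow> ('k, 'w, 'n) module_scheme
      \<Rightarrow> ('k, 't, 'p) module_scheme \<Rightarrow> ('v \<Rightarrow> 'w \<Rightarrow> 't) \<Rightarrow> bool" where
  "bilinear_map K V W T b \<longleftrightarrow>
     (\<forall>v\<in>carrier V. (\<lambda>w. b v w) \<in> LinearCombinations.module_hom K W T) \<and>
     (\<forall>w\<in>carrier W. (\<lambda>v. b v w) \<in> LinearCombinations.module_hom K V T)"

text \<open>The linear map \<open>V \<otimes> W \<rightarrow> T\<close> induced by a bilinear map \<open>b\<close>.  Existence and uniqueness are shown
  in \<open>tensor_universal\<close> below.\<close>

definition tensor_lift ::
    "('k, 'r) ring_scheme \<Rightarrow> ('k, 'v, 'm) module_scheme \<Rightarrow> ('k, 'w, 'n) module_scheme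
      \<Rightarrow> ('k, 't, 'p) module_scheme \<Rightarrow> ('v \<Rightarrow> 'w \<Rightarrow> 't)
      \<Rightarrow> ('v \<times> 'w \<Rightarrow>\<^sub>0 int) set \<Rightarrow> 't" where
  "tensor_lift K V W T b =
     (THE h. h \<in> extensional (carrier (tensor_product K V W)) \<and>
        h \<in> LinearCombinations.module_hom K (tensor_product K V W) T \<and>
        (\<forall>v\<in>carrier V. \<forall>w\<in>carrier W. h (tensor K V W v w) = b v w))"

text \<open>The map \<open>f \<otimes> g : V \<otimes> W \<rightarrow> V' \<otimes> W'\<close>.\<close>

definition tensor_map ::
    "('k, 'r) ring_scheme \<Rightarrow> ('k, 'v, 'm) module_scheme \<Rightarrow> ('k, 'w, 'n) module_scheme
      \<Rightarrow> ('k, 'v1, 'm1) module_scheme \<Rightarrow> ('k, 'w1, 'n1) module_scheme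
      \<Rightarrow> ('v \<Rightarrow> 'v1) \<Rightarrow> ('w \<Rightarrow> 'w1)
      \<Rightarrow> ('v \<times> 'w \<Rightarrow>\<^sub>0 int) set \<Rightarrow> ('v1 \<times> 'w1 \<Rightarrow>\<^sub>0 int) set" where
  "tensor_map K V W V' W' f g =
     tensor_lift K V W (tensor_product K V' W') (\<lambda>v w. tensor K V' W' (f v) (g w))"

text \<open>The canonical isomorphism \<open>(U \<otimes> V) \<otimes> W \<rightarrow> U \<otimes> (V \<otimes> W)\<close>, \<open>(u \<otimes> v) \<otimes> w \<mapsto> u \<otimes> (v \<otimes> w)\<close>.\<close>

definition tensor_assoc ::
    "('k, 'r) ring_scheme \<Rightarrow> ('k, 'u, 'l) module_scheme \<Rightarrow> ('k, 'v, 'm) module_scheme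
      \<Rightarrow> ('k, 'w, 'n) module_scheme
      \<Rightarrow> (('u \<times> 'v \<Rightarrow>\<^sub>0 int) set \<times> 'w \<Rightarrow>\<^sub>0 int) set
      \<Rightarrow> ('u \<times> ('v \<times> 'w \<Rightarrow>\<^sub>0 int) set \<Rightarrow>\<^sub>0 int) set" where
  "tensor_assoc K U V W =
     (let T = tensor_product K U (tensor_product K V W) in
      tensor_lift K (tensor_product K U V) W T
        (\<lambda>t w. tensor_lift K U V T
                 (\<lambda>u v. tensor K U (tensor_product K V W) u (tensor K V W v w)) t))"

lemma hom_free_Abelian_group_eqI:
  assumes G: "group G"
    and h: "h \<in> hom (free_Abelian_group S) G" and h': "h' \<in> hom (free_Abelian_group S) G"
    and eq: "\<And>s. s \<in> S \<Longrightarrow> h (frag_of s) = h' (frag_of s)"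
    and x: "x \<in> carrier (free_Abelian_group S)"
  shows "h x = h' x"
proof -
  interpret G: group G by (rule G)
  interpret h: group_hom "free_Abelian_group S" G h
    using h by (simp add: group_hom_def group_hom_axioms_def G)
  interpret h': group_hom "free_Abelian_group S" G h'
    using h' by (simp add: group_hom_def group_hom_axioms_def G)
  have "Poly_Mapping.keys x \<subseteq> S" using x by simp
  then show ?thesis
  proof (induction x rule: free_Abelian_group_induct [consumes 1, case_names zero diff basis])
    case zero
    then show ?case using h.hom_one h'.hom_one by simp
  next
    case (diff x y)
    have c: "x \<in> carrier (free_Abelian_group S)" "y \<in> carrier (free_Abelian_group S)"
      using diff by auto
    have "x - y = x \<otimes>\<^bsub>free_Abelian_group S\<^esub> inv\<^bsub>free_Abelian_group S\<^esub> y"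
      using diff by simp
    then show ?case using diff c h.hom_mult h'.hom_mult h.hom_inv h'.hom_inv
      by (metis group.inv_closed group_free_Abelian_group)
  next
    case (basis a)
    then show ?case by (rule eq)
  qed
qed

lemma hom_free_Abelian_group_diff:
  assumes G: "group G" and h: "h \<in> hom (free_Abelian_group S) G"
    and "x \<in> carrier (free_Abelian_group S)" "y \<in> carrier (free_Abelian_group S)"
  shows "h (x - y) = h x \<otimes>\<^bsub>G\<^esub> inv\<^bsub>G\<^esub> h y"
proof -
  interpret h: group_hom "free_Abelian_group S" G h
    using h by (simp add: group_hom_def group_hom_axioms_def G)
  have "x - y = x \<otimes>\<^bsub>free_Abelian_group S\<^esub> inv\<^bsub>free_Abelian_group S\<^esub> y"
    using assms(4) by simp
  then show ?thesis using assms(3,4) h.hom_mult h.hom_inv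
    by (metis h.G.inv_closed)
qed

lemma frag_extend_hom:
  assumes "\<And>s. s \<in> S \<Longrightarrow> f s \<in> S'"
  shows "frag_extend (\<lambda>s. frag_of (f s)) \<in> hom (free_Abelian_group S) (free_Abelian_group S')"
proof (rule homI)
  fix x assume "x \<in> carrier (free_Abelian_group S)"
  then show "frag_extend (\<lambda>s. frag_of (f s)) x \<in> carrier (free_Abelian_group S')"
    using keys_frag_extend[of "\<lambda>s. frag_of (f s)" x] assms by (fastforce)
qed (simp add: frag_extend_add)

declare carrier_free_Abelian_group_iff [simp del]

locale module_pair = V: Module.module K V + W: Module.module K W
  for K :: "('k, 'r) ring_scheme" (structure)
    and V :: "('k, 'v, 'm) module_scheme"
    and W :: "('k, 'w, 'n) module_scheme"
begin

abbreviation "F \<equiv> free_Abelian_group (carrier V \<times> carrier W)"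
abbreviation "N \<equiv> tensor_null K V W"
abbreviation "cl \<equiv> tensor_class K V W"
abbreviation "T \<equiv> tensor_product K V W"

lemma F_add: "x \<in> carrier F \<Longrightarrow> y \<in> carrier F \<Longrightarrow> x + y \<in> carrier F"
  using keys_add[of x y] by (auto simp: carrier_free_Abelian_group_iff)

lemma F_diff: "x \<in> carrier F \<Longrightarrow> y \<in> carrier F \<Longrightarrow> x - y \<in> carrier F"
  using keys_diff[of x y] by (auto simp: carrier_free_Abelian_group_iff)

lemma relators_closed: "tensor_relators K V W \<subseteq> carrier F"
  unfolding tensor_relators_def by (auto intro!: F_diff)

lemma F_comm: "comm_group F" by (rule abelian_free_Abelian_group)

lemma F_group: "group F" by simp

lemma N_subgroup: "subgroup N F"
  unfolding tensor_null_def by (rule group.generate_is_subgroup[OF F_group relators_closed])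

lemma N_normal: "N \<lhd> F"
  using comm_group.normal_iff_subgroup[OF F_comm] N_subgroup by blast

lemma Q_comm: "comm_group (F Mod N)"
  by (rule comm_group.abelian_FactGroup[OF F_comm N_subgroup])

lemma cl_hom: "cl \<in> hom F (F Mod N)"
  using normal.r_coset_hom_Mod[OF N_normal] by (simp add: tensor_class_def[abs_def])

lemma carrier_T: "carrier T = cl ` carrier F"
  by (simp add: tensor_product_def Let_def carrier_FactGroup tensor_class_def)

lemma T_Q: "carrier T = carrier (F Mod N)" "add T = (\<otimes>\<^bsub>F Mod N\<^esub>)" "\<zero>\<^bsub>T\<^esub> = \<one>\<^bsub>F Mod N\<^esub>"
  by (simp_all add: tensor_product_def Let_def)

lemma hom_null:
  assumes "group G" "h \<in> hom F G" "\<And>r. r \<in> tensor_relators K V W \<Longrightarrow> h r = \<one>\<^bsub>G\<^esub>" "x \<in> N"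
  shows "h x = \<one>\<^bsub>G\<^esub>"
proof -
  interpret h: group_hom F G h
    using assms by (simp add: group_hom_def group_hom_axioms_def)
  have "generate F (tensor_relators K V W) \<subseteq> kernel F G h"
  proof (rule group.generate_subgroup_incl[OF F_group])
    show "tensor_relators K V W \<subseteq> kernel F G h"
      using relators_closed assms(3) unfolding kernel_def by blast
    show "subgroup (kernel F G h) F" by (rule h.subgroup_kernel)
  qed
  with assms(4) show ?thesis by (auto simp: kernel_def tensor_null_def)
qed

lemma cl_self: "x \<in> carrier F \<Longrightarrow> x \<in> cl x"
  unfolding tensor_class_def using group.rcos_self[OF F_group _ N_subgroup] by blast

lemma cl_eqI: "x \<in> carrier F \<Longrightarrow> y \<in> cl x \<Longrightarrow> cl y = cl x"
  unfolding tensor_class_def using group.repr_independence[OF F_group _ _ N_subgroup] by metis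

lemma cl_closed: "x \<in> carrier F \<Longrightarrow> y \<in> cl x \<Longrightarrow> y \<in> carrier F"
  unfolding tensor_class_def
  using monoid.r_coset_subset_G[OF group.is_monoid[OF F_group] subgroup.subset[OF N_subgroup]] by blast

lemma factor_cl:
  assumes G: "group G" and h: "h \<in> hom F G"
    and r: "\<And>r. r \<in> tensor_relators K V W \<Longrightarrow> h r = \<one>\<^bsub>G\<^esub>"
    and x: "x \<in> carrier F" and y: "y \<in> cl x"
  shows "h y = h x"
proof -
  obtain z where z: "z \<in> N" "y = z + x"
    using y by (auto simp: tensor_class_def r_coset_def)
  have "z \<in> carrier F" using z subgroup.subset[OF N_subgroup] by blast
  then have "h y = h z \<otimes>\<^bsub>G\<^esub> h x" using hom_mult[OF h, of z x] x z by simp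
  moreover have "h z = \<one>\<^bsub>G\<^esub>" using hom_null[OF G h r z(1)] .
  moreover have "h x \<in> carrier G" using h x by (auto simp: hom_def)
  ultimately show ?thesis using G by (simp add: group.is_monoid)
qed

lemma cl_relator: "r \<in> tensor_relators K V W \<Longrightarrow> cl r = N"
  unfolding tensor_class_def
  by (rule subgroup.rcos_const[OF N_subgroup F_group])
     (simp add: tensor_null_def generate.incl)

lemma cl_diff:
  assumes "x \<in> carrier F" "y \<in> carrier F" "cl (x - y) = N"
  shows "cl x = cl y"
proof -
  interpret Q: comm_group "F Mod N" by (rule Q_comm)
  have "cl (x - y) = cl x \<otimes>\<^bsub>F Mod N\<^esub> inv\<^bsub>F Mod N\<^esub> cl y"
    by (rule hom_free_Abelian_group_diff[OF Q.group_axioms cl_hom]) (use assms in auto)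
  then have e: "cl x \<otimes>\<^bsub>F Mod N\<^esub> inv\<^bsub>F Mod N\<^esub> cl y = \<one>\<^bsub>F Mod N\<^esub>" using assms(3) by simp
  have c: "cl x \<in> carrier (F Mod N)" "cl y \<in> carrier (F Mod N)"
    using cl_hom assms by (auto simp: hom_def)
  show ?thesis using Q.inv_equality[OF e] c by simp
qed

lemma tensor_closed:
  "v \<in> carrier V \<Longrightarrow> w \<in> carrier W \<Longrightarrow> tensor K V W v w \<in> carrier T"
  by (auto simp: tensor_def carrier_T)

lemma add_T: "x \<in> carrier F \<Longrightarrow> y \<in> carrier F \<Longrightarrow> cl x \<oplus>\<^bsub>T\<^esub> cl y = cl (x + y)"
  using hom_mult[OF cl_hom, of x y] by (simp add: tensor_product_def Let_def)

lemma tensor_add_left: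
  assumes "v \<in> carrier V" "v' \<in> carrier V" "w \<in> carrier W"
  shows "tensor K V W (v \<oplus>\<^bsub>V\<^esub> v') w = tensor K V W v w \<oplus>\<^bsub>T\<^esub> tensor K V W v' w"
proof -
  have "frag_of (v \<oplus>\<^bsub>V\<^esub> v', w) - (frag_of (v, w) + frag_of (v', w)) \<in> tensor_relators K V W"
    unfolding tensor_relators_def using assms by (auto simp: diff_diff_add)
  then have "cl (frag_of (v \<oplus>\<^bsub>V\<^esub> v', w)) = cl (frag_of (v, w) + frag_of (v', w))"
    using assms by (intro cl_diff cl_relator F_add) auto
  then show ?thesis using assms by (simp add: tensor_def add_T)
qed

lemma tensor_add_right:
  assumes "v \<in> carrier V" "w \<in> carrier W" "w' \<in> carrier W"
  shows "tensor K V W v (w \<oplus>\<^bsub>W\<^esub> w') = tensor K V W v w \<oplus>\<^bsub>T\<^esub> tensor K V W v w'"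
proof -
  have "frag_of (v, w \<oplus>\<^bsub>W\<^esub> w') - (frag_of (v, w) + frag_of (v, w')) \<in> tensor_relators K V W"
    unfolding tensor_relators_def using assms by (auto simp: diff_diff_add)
  then have "cl (frag_of (v, w \<oplus>\<^bsub>W\<^esub> w')) = cl (frag_of (v, w) + frag_of (v, w'))"
    using assms by (intro cl_diff cl_relator F_add) auto
  then show ?thesis using assms by (simp add: tensor_def add_T)
qed

lemma tensor_balanced:
  assumes "a \<in> carrier K" "v \<in> carrier V" "w \<in> carrier W"
  shows "tensor K V W (a \<odot>\<^bsub>V\<^esub> v) w = tensor K V W v (a \<odot>\<^bsub>W\<^esub> w)"
  unfolding tensor_def
proof (rule cl_diff[OF _ _ cl_relator])
  show "frag_of (a \<odot>\<^bsub>V\<^esub> v, w) - frag_of (v, a \<odot>\<^bsub>W\<^esub> w) \<in> tensor_relators K V W"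
    unfolding tensor_relators_def using assms by blast
qed (use assms in auto)

abbreviation "sc a \<equiv> frag_extend (\<lambda>(v, w). frag_of (a \<odot>\<^bsub>V\<^esub> v, w))"

lemma sc_hom:
  assumes a: "a \<in> carrier K"
  shows "sc a \<in> hom F F"
proof -
  have "(\<lambda>s :: 'v \<times> 'w. frag_of (case s of (v, w) \<Rightarrow> (a \<odot>\<^bsub>V\<^esub> v, w)))
      = (\<lambda>(v, w). frag_of (a \<odot>\<^bsub>V\<^esub> v, w))"
    by (rule ext) (rule prod.case_distrib)
  moreover have "frag_extend (\<lambda>s. frag_of (case s of (v, w) \<Rightarrow> (a \<odot>\<^bsub>V\<^esub> v, w))) \<in> hom F F"
    by (rule frag_extend_hom) (use a in auto)
  ultimately show ?thesis by (rule subst[where P = "\<lambda>f. frag_extend f \<in> hom F F"])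
qed

lemma sc_closed: "a \<in> carrier K \<Longrightarrow> x \<in> carrier F \<Longrightarrow> sc a x \<in> carrier F"
  using sc_hom by (fastforce simp: hom_def)

lemma cl_sc_hom: "a \<in> carrier K \<Longrightarrow> (\<lambda>x. cl (sc a x)) \<in> hom F (F Mod N)"
  using hom_compose[OF sc_hom cl_hom] by (simp add: comp_def)

lemma Q_comb:
  assumes h: "h \<in> hom F G" and G: "comm_group G"
    and s: "s \<in> carrier V \<times> carrier W" "s1 \<in> carrier V \<times> carrier W" "s2 \<in> carrier V \<times> carrier W"
    and eq: "h (frag_of s) = h (frag_of s1) \<otimes>\<^bsub>G\<^esub> h (frag_of s2)"
  shows "h (frag_of s - frag_of s1 - frag_of s2) = \<one>\<^bsub>G\<^esub>"
proof -
  interpret G: comm_group G by (rule G)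
  have c: "h (frag_of s) \<in> carrier G" "h (frag_of s1) \<in> carrier G" "h (frag_of s2) \<in> carrier G"
    using h s by (auto simp: hom_def Pi_iff)
  have "h (frag_of s - (frag_of s1 + frag_of s2)) = h (frag_of s) \<otimes>\<^bsub>G\<^esub> inv\<^bsub>G\<^esub> h (frag_of s1 + frag_of s2)"
    by (rule hom_free_Abelian_group_diff[OF G.group_axioms h])
       (use s in \<open>auto intro!: F_add\<close>)
  also have "h (frag_of s1 + frag_of s2) = h (frag_of s)"
    using hom_mult[OF h, of "frag_of s1" "frag_of s2"] s eq by simp
  finally show ?thesis using c by (simp add: diff_diff_add)
qed

lemma hom_kills_relators:
  assumes h: "h \<in> hom F G" and G: "comm_group G"
    and add_left: "\<And>v v' w. v \<in> carrier V \<Longrightarrow> v' \<in> carrier V \<Longrightarrow> w \<in> carrier W \<Longrightarrow>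
       h (frag_of (v \<oplus>\<^bsub>V\<^esub> v', w)) = h (frag_of (v, w)) \<otimes>\<^bsub>G\<^esub> h (frag_of (v', w))"
    and add_right: "\<And>v w w'. v \<in> carrier V \<Longrightarrow> w \<in> carrier W \<Longrightarrow> w' \<in> carrier W \<Longrightarrow>
       h (frag_of (v, w \<oplus>\<^bsub>W\<^esub> w')) = h (frag_of (v, w)) \<otimes>\<^bsub>G\<^esub> h (frag_of (v, w'))"
    and bal: "\<And>a v w. a \<in> carrier K \<Longrightarrow> v \<in> carrier V \<Longrightarrow> w \<in> carrier W \<Longrightarrow>
       h (frag_of (a \<odot>\<^bsub>V\<^esub> v, w)) = h (frag_of (v, a \<odot>\<^bsub>W\<^esub> w))"
    and r: "r \<in> tensor_relators K V W"
  shows "h r = \<one>\<^bsub>G\<^esub>"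
proof -
  interpret G: comm_group G by (rule G)
  show ?thesis using r unfolding tensor_relators_def
  proof (elim UnE CollectE exE conjE, goal_cases)
    case (1 v v' w)
    then show ?case by (auto intro!: Q_comb[OF h G] add_left)
  next
    case (2 v w w')
    then show ?case by (auto intro!: Q_comb[OF h G] add_right)
  next
    case (3 a v w)
    then have "h r = h (frag_of (a \<odot>\<^bsub>V\<^esub> v, w)) \<otimes>\<^bsub>G\<^esub> inv\<^bsub>G\<^esub> h (frag_of (v, a \<odot>\<^bsub>W\<^esub> w))"
      using hom_free_Abelian_group_diff[OF G.group_axioms h] by simp
    moreover have "h (frag_of (v, a \<odot>\<^bsub>W\<^esub> w)) \<in> carrier G"
      using h 3 by (auto simp: hom_def Pi_iff)
    ultimately show ?case using bal[OF 3(2-4)] by simp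
  qed
qed

lemma smult_T:
  assumes a: "a \<in> carrier K" and x: "x \<in> carrier F"
  shows "a \<odot>\<^bsub>T\<^esub> cl x = cl (sc a x)"
proof -
  interpret Q: comm_group "F Mod N" by (rule Q_comm)
  have add: "add T = (\<otimes>\<^bsub>F Mod N\<^esub>)" by (simp add: tensor_product_def Let_def)
  have "cl (sc a y) = cl (sc a x)" if y: "y \<in> cl x" for y
  proof (rule factor_cl[OF Q.group_axioms cl_sc_hom[OF a] _ x y])
    fix r assume r: "r \<in> tensor_relators K V W"
    show "cl (sc a r) = \<one>\<^bsub>F Mod N\<^esub>"
    proof (rule hom_kills_relators[OF cl_sc_hom[OF a] Q_comm _ _ _ r]; simp only: frag_extend_of prod.case)
      fix v v' w assume "v \<in> carrier V" "v' \<in> carrier V" "w \<in> carrier W"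
      then show "cl (frag_of (a \<odot>\<^bsub>V\<^esub> (v \<oplus>\<^bsub>V\<^esub> v'), w))
          = cl (frag_of (a \<odot>\<^bsub>V\<^esub> v, w)) \<otimes>\<^bsub>F Mod N\<^esub> cl (frag_of (a \<odot>\<^bsub>V\<^esub> v', w))"
        using tensor_add_left[of "a \<odot>\<^bsub>V\<^esub> v" "a \<odot>\<^bsub>V\<^esub> v'" w] a
        unfolding tensor_def add by (simp only: V.smult_closed V.smult_r_distr)
    next
      fix v w w' assume "v \<in> carrier V" "w \<in> carrier W" "w' \<in> carrier W"
      then show "cl (frag_of (a \<odot>\<^bsub>V\<^esub> v, w \<oplus>\<^bsub>W\<^esub> w'))
          = cl (frag_of (a \<odot>\<^bsub>V\<^esub> v, w)) \<otimes>\<^bsub>F Mod N\<^esub> cl (frag_of (a \<odot>\<^bsub>V\<^esub> v, w'))"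
        using tensor_add_right[of "a \<odot>\<^bsub>V\<^esub> v" w w'] a
        unfolding tensor_def add by (simp only: V.smult_closed)
    next
      fix b v w assume bvw: "b \<in> carrier K" "v \<in> carrier V" "w \<in> carrier W"
      have "a \<odot>\<^bsub>V\<^esub> (b \<odot>\<^bsub>V\<^esub> v) = (a \<otimes> b) \<odot>\<^bsub>V\<^esub> v"
        by (rule V.smult_assoc1[OF a bvw(1,2), symmetric])
      also have "\<dots> = (b \<otimes> a) \<odot>\<^bsub>V\<^esub> v"
        by (rule arg_cong[OF V.R.m_comm[OF a bvw(1)]])
      also have "\<dots> = b \<odot>\<^bsub>V\<^esub> (a \<odot>\<^bsub>V\<^esub> v)"
        by (rule V.smult_assoc1[OF bvw(1) a bvw(2)])
      finally have comm: "a \<odot>\<^bsub>V\<^esub> (b \<odot>\<^bsub>V\<^esub> v) = b \<odot>\<^bsub>V\<^esub> (a \<odot>\<^bsub>V\<^esub> v)" .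
      show "cl (frag_of (a \<odot>\<^bsub>V\<^esub> (b \<odot>\<^bsub>V\<^esub> v), w)) = cl (frag_of (a \<odot>\<^bsub>V\<^esub> v, b \<odot>\<^bsub>W\<^esub> w))"
        unfolding comm by (rule tensor_balanced[unfolded tensor_def]) (use a bvw in auto)
    qed
  qed
  then have "(\<Union>y\<in>cl x. cl (sc a y)) = cl (sc a x)"
    by (intro SUP_eq_const) (use cl_self[OF x] in \<open>blast+\<close>)
  then show ?thesis unfolding tensor_product_def Let_def module.select_convs .
qed

lemma smult_tensor_left:
  assumes "a \<in> carrier K" "v \<in> carrier V" "w \<in> carrier W"
  shows "a \<odot>\<^bsub>T\<^esub> tensor K V W v w = tensor K V W (a \<odot>\<^bsub>V\<^esub> v) w"
  unfolding tensor_def using smult_T[of a "frag_of (v, w)"] assms by simp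

lemma smult_tensor_right:
  assumes "a \<in> carrier K" "v \<in> carrier V" "w \<in> carrier W"
  shows "a \<odot>\<^bsub>T\<^esub> tensor K V W v w = tensor K V W v (a \<odot>\<^bsub>W\<^esub> w)"
  using smult_tensor_left tensor_balanced assms by simp

lemma T_abelian: "abelian_group T"
proof -
  interpret Q: comm_group "F Mod N" by (rule Q_comm)
  show ?thesis
  proof (rule abelian_groupI)
    fix X assume "X \<in> carrier T"
    then show "\<exists>Y\<in>carrier T. Y \<oplus>\<^bsub>T\<^esub> X = \<zero>\<^bsub>T\<^esub>"
      unfolding T_Q by (intro bexI[of _ "inv\<^bsub>F Mod N\<^esub> X"] Q.l_inv Q.inv_closed)
  qed (unfold T_Q, simp_all only: Q.m_closed Q.one_closed Q.l_one Q.r_one Q.m_ac)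
qed

lemma T_module: "Module.module K T"
proof -
  interpret T: abelian_group T by (rule T_abelian)
  interpret Q: comm_group "F Mod N" by (rule Q_comm)
  have add: "add T = (\<otimes>\<^bsub>F Mod N\<^esub>)" by (simp add: tensor_product_def Let_def)
  show ?thesis
  proof (rule moduleI)
    show "cring K" by (rule V.R.cring_axioms)
    show "abelian_group T" by (rule T_abelian)
    fix a X assume a: "a \<in> carrier K" and "X \<in> carrier T"
    then obtain x where x: "x \<in> carrier F" "X = cl x" by (auto simp: carrier_T)
    show "a \<odot>\<^bsub>T\<^esub> X \<in> carrier T"
      using smult_T[OF a x(1)] sc_closed[OF a x(1)] x(2) by (simp add: carrier_T)
    show "\<And>Y. Y \<in> carrier T \<Longrightarrow> a \<odot>\<^bsub>T\<^esub> (X \<oplus>\<^bsub>T\<^esub> Y) = a \<odot>\<^bsub>T\<^esub> X \<oplus>\<^bsub>T\<^esub> a \<odot>\<^bsub>T\<^esub> Y"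
    proof -
      fix Y assume "Y \<in> carrier T"
      then obtain y where y: "y \<in> carrier F" "Y = cl y" by (auto simp: carrier_T)
      show "a \<odot>\<^bsub>T\<^esub> (X \<oplus>\<^bsub>T\<^esub> Y) = a \<odot>\<^bsub>T\<^esub> X \<oplus>\<^bsub>T\<^esub> a \<odot>\<^bsub>T\<^esub> Y"
        using x y smult_T[OF a] add_T sc_closed[OF a] F_add
        by (simp add: frag_extend_add)
    qed
    show "\<And>b. b \<in> carrier K \<Longrightarrow> (a \<oplus>\<^bsub>K\<^esub> b) \<odot>\<^bsub>T\<^esub> X = a \<odot>\<^bsub>T\<^esub> X \<oplus>\<^bsub>T\<^esub> b \<odot>\<^bsub>T\<^esub> X"
    proof -
      fix b assume b: "b \<in> carrier K"
      have "cl (sc (a \<oplus>\<^bsub>K\<^esub> b) x) = cl (sc a x) \<otimes>\<^bsub>F Mod N\<^esub> cl (sc b x)"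
      proof (rule hom_free_Abelian_group_eqI[OF Q.group_axioms cl_sc_hom _ _ x(1)])
        show "(\<lambda>x. cl (sc a x) \<otimes>\<^bsub>F Mod N\<^esub> cl (sc b x)) \<in> hom F (F Mod N)"
          using Q.hom_group_mult[OF cl_sc_hom[OF a] cl_sc_hom[OF b]] .
        fix s assume "s \<in> carrier V \<times> carrier W"
        then obtain v w where s: "s = (v, w)" "v \<in> carrier V" "w \<in> carrier W" by auto
        show "cl (sc (a \<oplus>\<^bsub>K\<^esub> b) (frag_of s))
            = cl (sc a (frag_of s)) \<otimes>\<^bsub>F Mod N\<^esub> cl (sc b (frag_of s))"
          using tensor_add_left[of "a \<odot>\<^bsub>V\<^esub> v" "b \<odot>\<^bsub>V\<^esub> v" w] s a b
          by (simp add: tensor_def V.smult_l_distr add)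
      qed (use a b in simp)
      then show "(a \<oplus>\<^bsub>K\<^esub> b) \<odot>\<^bsub>T\<^esub> X = a \<odot>\<^bsub>T\<^esub> X \<oplus>\<^bsub>T\<^esub> b \<odot>\<^bsub>T\<^esub> X"
        using smult_T[OF _ x(1)] a b x(2) by (simp add: add)
    qed
    show "\<And>b. b \<in> carrier K \<Longrightarrow> (a \<otimes>\<^bsub>K\<^esub> b) \<odot>\<^bsub>T\<^esub> X = a \<odot>\<^bsub>T\<^esub> (b \<odot>\<^bsub>T\<^esub> X)"
    proof -
      fix b assume b: "b \<in> carrier K"
      have "sc (a \<otimes>\<^bsub>K\<^esub> b) x = sc a (sc b x)"
      proof (rule hom_free_Abelian_group_eqI[OF F_group sc_hom _ _ x(1)])
        show "(\<lambda>x. sc a (sc b x)) \<in> hom F F"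
          using hom_compose[OF sc_hom[OF b] sc_hom[OF a]] by (simp add: comp_def)
      qed (use a b in \<open>auto simp: V.smult_assoc1\<close>)
      then show "(a \<otimes>\<^bsub>K\<^esub> b) \<odot>\<^bsub>T\<^esub> X = a \<odot>\<^bsub>T\<^esub> (b \<odot>\<^bsub>T\<^esub> X)"
        using smult_T a b x sc_closed[OF b x(1)] by simp
    qed
  next
    fix X assume "X \<in> carrier T"
    then obtain x where x: "x \<in> carrier F" "X = cl x" by (auto simp: carrier_T)
    have "sc \<one>\<^bsub>K\<^esub> x = id x"
      by (rule hom_free_Abelian_group_eqI[OF F_group sc_hom _ _ x(1)]) (auto simp: hom_def)
    then show "\<one>\<^bsub>K\<^esub> \<odot>\<^bsub>T\<^esub> X = X" using smult_T[OF _ x(1)] x(2) by simp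
  qed
qed

lemma tensor_bilinear: "bilinear_map K V W T (tensor K V W)"
  unfolding bilinear_map_def LinearCombinations.module_hom_def
  by (auto simp: tensor_closed tensor_add_left tensor_add_right smult_tensor_left
      smult_tensor_right[symmetric])

lemma module_hom_eqI:
  assumes P: "Module.module K P"
    and g: "g \<in> LinearCombinations.module_hom K T P"
    and g': "g' \<in> LinearCombinations.module_hom K T P"
    and eq: "\<And>v w. v \<in> carrier V \<Longrightarrow> w \<in> carrier W \<Longrightarrow> g (tensor K V W v w) = g' (tensor K V W v w)"
    and X: "X \<in> carrier T"
  shows "g X = g' X"
proof -
  interpret P: Module.module K P by (rule P)
  obtain x where x: "x \<in> carrier F" "X = cl x" using X by (auto simp: carrier_T)
  have hom: "(\<lambda>x. h (cl x)) \<in> hom F (add_monoid P)"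
    if "h \<in> LinearCombinations.module_hom K T P" for h
    using that F_add unfolding LinearCombinations.module_hom_def
    by (auto intro!: homI simp: carrier_T add_T[symmetric])
  have "g (cl x) = g' (cl x)"
    by (rule hom_free_Abelian_group_eqI[OF P.a_group hom[OF g] hom[OF g'] _ x(1)])
       (use eq in \<open>auto simp: tensor_def\<close>)
  then show ?thesis using x by simp
qed

theorem tensor_universal:
  assumes P: "Module.module K P" and b: "bilinear_map K V W P b"
  shows "\<exists>!h. h \<in> extensional (carrier T) \<and> h \<in> LinearCombinations.module_hom K T P \<and>
    (\<forall>v\<in>carrier V. \<forall>w\<in>carrier W. h (tensor K V W v w) = b v w)"
proof -
  interpret P: Module.module K P by (rule P)
  have b_closed: "\<And>v w. v \<in> carrier V \<Longrightarrow> w \<in> carrier W \<Longrightarrow> b v w \<in> carrier P"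
    and bl: "\<And>v v' w. v \<in> carrier V \<Longrightarrow> v' \<in> carrier V \<Longrightarrow> w \<in> carrier W \<Longrightarrow>
        b (v \<oplus>\<^bsub>V\<^esub> v') w = b v w \<oplus>\<^bsub>P\<^esub> b v' w"
    and br: "\<And>v w w'. v \<in> carrier V \<Longrightarrow> w \<in> carrier W \<Longrightarrow> w' \<in> carrier W \<Longrightarrow>
        b v (w \<oplus>\<^bsub>W\<^esub> w') = b v w \<oplus>\<^bsub>P\<^esub> b v w'"
    and sl: "\<And>a v w. a \<in> carrier K \<Longrightarrow> v \<in> carrier V \<Longrightarrow> w \<in> carrier W \<Longrightarrow>
        b (a \<odot>\<^bsub>V\<^esub> v) w = a \<odot>\<^bsub>P\<^esub> b v w"
    and sr: "\<And>a v w. a \<in> carrier K \<Longrightarrow> v \<in> carrier V \<Longrightarrow> w \<in> carrier W \<Longrightarrow>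
        b v (a \<odot>\<^bsub>W\<^esub> w) = a \<odot>\<^bsub>P\<^esub> b v w"
    using b unfolding bilinear_map_def LinearCombinations.module_hom_def by auto
  obtain h where h: "h \<in> hom F (add_monoid P)"
    "\<And>s. s \<in> carrier V \<times> carrier W \<Longrightarrow> h (frag_of s) = (case s of (v, w) \<Rightarrow> b v w)"
    using comm_group.free_Abelian_group_universal[OF P.a_comm_group, of "\<lambda>(v, w). b v w" "carrier V \<times> carrier W"] b_closed
    by (auto simp: image_subset_iff)
  have kills: "h r = \<one>\<^bsub>add_monoid P\<^esub>" if "r \<in> tensor_relators K V W" for r
    by (rule hom_kills_relators[OF h(1) P.a_comm_group _ _ _ that])
       (simp_all add: h(2) bl br sl sr)
  have eq: "h x = h y" if "x \<in> carrier F" "y \<in> carrier F" "cl x = cl y" for x y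
    using factor_cl[OF P.a_group h(1) kills that(2)] cl_self[OF that(1)] that(3) by simp
  obtain g where g: "g \<in> hom (F Mod N) (add_monoid P)" "\<And>x. x \<in> carrier F \<Longrightarrow> g (cl x) = h x"
    using FactGroup_universal[OF h(1) N_normal] eq unfolding tensor_class_def by metis
  have smult: "g (a \<odot>\<^bsub>T\<^esub> X) = a \<odot>\<^bsub>P\<^esub> g X" if a: "a \<in> carrier K" and X: "X \<in> carrier T" for a X
  proof -
    obtain x where x: "x \<in> carrier F" "X = cl x" using X by (auto simp: carrier_T)
    have "h (sc a x) = a \<odot>\<^bsub>P\<^esub> h x"
    proof (rule hom_free_Abelian_group_eqI[OF P.a_group _ _ _ x(1)])
      show "(\<lambda>x. h (sc a x)) \<in> hom F (add_monoid P)"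
        using hom_compose[OF sc_hom[OF a] h(1)] by (simp add: comp_def)
      show "(\<lambda>x. a \<odot>\<^bsub>P\<^esub> h x) \<in> hom F (add_monoid P)"
        using h(1) a by (auto simp: hom_def P.smult_r_distr Pi_iff)
      fix s assume "s \<in> carrier V \<times> carrier W"
      then show "h (sc a (frag_of s)) = a \<odot>\<^bsub>P\<^esub> h (frag_of s)" using a by (auto simp: h(2) sl)
    qed
    then show ?thesis using g(2) x smult_T[OF a x(1)] sc_closed[OF a x(1)] by simp
  qed
  let ?g = "restrict g (carrier T)"
  interpret T: Module.module K T by (rule T_module)
  have gT: "?g \<in> LinearCombinations.module_hom K T P"
    using g(1) smult T.M.add.m_closed T.smult_closed
    by (auto simp: LinearCombinations.module_hom_def hom_def T_Q(1)[symmetric] T_Q(2))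
  have gt: "?g (tensor K V W v w) = b v w" if "v \<in> carrier V" "w \<in> carrier W" for v w
    using that g(2)[of "frag_of (v, w)"] h(2)[of "(v, w)"] tensor_closed[OF that]
    by (simp add: tensor_def)
  show ?thesis
  proof (rule ex1I[of _ ?g])
    show "?g \<in> extensional (carrier T) \<and> ?g \<in> LinearCombinations.module_hom K T P \<and>
      (\<forall>v\<in>carrier V. \<forall>w\<in>carrier W. ?g (tensor K V W v w) = b v w)"
      using gT gt by auto
    fix k assume k: "k \<in> extensional (carrier T) \<and> k \<in> LinearCombinations.module_hom K T P \<and>
      (\<forall>v\<in>carrier V. \<forall>w\<in>carrier W. k (tensor K V W v w) = b v w)"
    show "k = ?g"
    proof (rule extensionalityI[of _ "carrier T"])
      fix X assume X: "X \<in> carrier T"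
      show "k X = ?g X"
        by (rule module_hom_eqI[OF P _ gT _ X]) (use k gt in auto)
    qed (use k in auto)
  qed
qed

lemma tensor_lift:
  assumes P: "Module.module K P" and b: "bilinear_map K V W P b"
  shows tensor_lift_hom: "tensor_lift K V W P b \<in> LinearCombinations.module_hom K T P"
    and tensor_lift_tensor: "\<And>v w. v \<in> carrier V \<Longrightarrow> w \<in> carrier W \<Longrightarrow>
      tensor_lift K V W P b (tensor K V W v w) = b v w"
  using theI'[OF tensor_universal[OF P b]] unfolding tensor_lift_def[symmetric] by auto

end

declare carrier_free_Abelian_group_iff [simp]

lemma vectorspace_tensor_product:
  assumes "vectorspace K V" "vectorspace K W"
  shows "vectorspace K (tensor_product K V W)"
proof -
  interpret V: vectorspace K V by fact
  interpret W: vectorspace K W by fact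
  interpret module_pair K V W ..
  show ?thesis using T_module V.field_axioms by (simp add: vectorspace_def)
qed

lemma tensor_map:
  assumes V: "Module.module K V" and W: "Module.module K W"
    and V': "Module.module K V'" and W': "Module.module K W'"
    and f: "f \<in> LinearCombinations.module_hom K V V'"
    and g: "g \<in> LinearCombinations.module_hom K W W'"
  shows tensor_map_hom: "tensor_map K V W V' W' f g
      \<in> LinearCombinations.module_hom K (tensor_product K V W) (tensor_product K V' W')"
    and tensor_map_tensor: "\<And>v w. v \<in> carrier V \<Longrightarrow> w \<in> carrier W \<Longrightarrow>
      tensor_map K V W V' W' f g (tensor K V W v w) = tensor K V' W' (f v) (g w)"
proof -
  interpret VW: module_pair K V W using V W by (simp add: module_pair_def)
  interpret VW': module_pair K V' W' using V' W' by (simp add: module_pair_def)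
  have "bilinear_map K V W (tensor_product K V' W') (\<lambda>v w. tensor K V' W' (f v) (g w))"
    using VW'.tensor_bilinear f g
    unfolding bilinear_map_def LinearCombinations.module_hom_def by (auto simp: Pi_iff)
  note * = VW.tensor_lift[OF VW'.T_module this, folded tensor_map_def]
  show "tensor_map K V W V' W' f g
      \<in> LinearCombinations.module_hom K (tensor_product K V W) (tensor_product K V' W')"
    and "\<And>v w. v \<in> carrier V \<Longrightarrow> w \<in> carrier W \<Longrightarrow>
      tensor_map K V W V' W' f g (tensor K V W v w) = tensor K V' W' (f v) (g w)"
    using * by auto
qed

lemma module_hom_add:
  assumes "Module.module K V" "Module.module K P"
    and "f \<in> LinearCombinations.module_hom K V P" "g \<in> LinearCombinations.module_hom K V P"
  shows "(\<lambda>v. f v \<oplus>\<^bsub>P\<^esub> g v) \<in> LinearCombinations.module_hom K V P"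
proof -
  interpret P: Module.module K P by fact
  show ?thesis
    using assms(3,4)
    by (auto simp: LinearCombinations.module_hom_def P.smult_r_distr P.a_ac Pi_iff)
qed

lemma module_hom_smult:
  assumes "Module.module K V" "Module.module K P" and a: "a \<in> carrier K"
    and "f \<in> LinearCombinations.module_hom K V P"
  shows "(\<lambda>v. a \<odot>\<^bsub>P\<^esub> f v) \<in> LinearCombinations.module_hom K V P"
proof -
  interpret P: Module.module K P by fact
  have "a \<odot>\<^bsub>P\<^esub> (b \<odot>\<^bsub>P\<^esub> x) = b \<odot>\<^bsub>P\<^esub> (a \<odot>\<^bsub>P\<^esub> x)" if "b \<in> carrier K" "x \<in> carrier P" for b x
  proof -
    have "a \<odot>\<^bsub>P\<^esub> (b \<odot>\<^bsub>P\<^esub> x) = (a \<otimes>\<^bsub>K\<^esub> b) \<odot>\<^bsub>P\<^esub> x"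
      using P.smult_assoc1 a that by simp
    also have "\<dots> = (b \<otimes>\<^bsub>K\<^esub> a) \<odot>\<^bsub>P\<^esub> x"
      using P.R.m_comm[OF a that(1)] by (rule arg_cong)
    also have "\<dots> = b \<odot>\<^bsub>P\<^esub> (a \<odot>\<^bsub>P\<^esub> x)"
      using P.smult_assoc1 a that by simp
    finally show ?thesis .
  qed
  then show ?thesis
    using assms(3,4)
    by (auto simp: LinearCombinations.module_hom_def P.smult_r_distr Pi_iff)
qed

lemma tensor_assoc:
  assumes U: "Module.module K U" and V: "Module.module K V" and W: "Module.module K W"
  shows tensor_assoc_hom: "tensor_assoc K U V W \<in> LinearCombinations.module_hom K
      (tensor_product K (tensor_product K U V) W) (tensor_product K U (tensor_product K V W))"
    and tensor_assoc_tensor: "\<And>u v w. u \<in> carrier U \<Longrightarrow> v \<in> carrier V \<Longrightarrow> w \<in> carrier W \<Longrightarrow>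
      tensor_assoc K U V W (tensor K (tensor_product K U V) W (tensor K U V u v) w)
        = tensor K U (tensor_product K V W) u (tensor K V W v w)"
proof -
  interpret UV: module_pair K U V using U V by (simp add: module_pair_def)
  interpret VW: module_pair K V W using V W by (simp add: module_pair_def)
  interpret L: module_pair K "tensor_product K U V" W
    using UV.T_module W by (simp add: module_pair_def)
  interpret R: module_pair K U "tensor_product K V W"
    using U VW.T_module by (simp add: module_pair_def)
  let ?T = "tensor_product K U (tensor_product K V W)"
  let ?b = "\<lambda>w u v. tensor K U (tensor_product K V W) u (tensor K V W v w)"
  let ?l = "\<lambda>w. tensor_lift K U V ?T (?b w)"
  have b: "bilinear_map K U V ?T (?b w)" if "w \<in> carrier W" for w
    using that R.tensor_bilinear VW.tensor_bilinear
    unfolding bilinear_map_def LinearCombinations.module_hom_def by (auto simp: Pi_iff)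
  note l = UV.tensor_lift[OF R.T_module b]
  have add: "?l (w \<oplus>\<^bsub>W\<^esub> w') t = ?l w t \<oplus>\<^bsub>?T\<^esub> ?l w' t"
    if "w \<in> carrier W" "w' \<in> carrier W" "t \<in> carrier (tensor_product K U V)" for w w' t
  proof (rule UV.module_hom_eqI[OF R.T_module l(1) module_hom_add[OF UV.T_module R.T_module l(1) l(1)] _ that(3)])
    fix u v assume "u \<in> carrier U" "v \<in> carrier V"
    then show "?l (w \<oplus>\<^bsub>W\<^esub> w') (tensor K U V u v)
        = ?l w (tensor K U V u v) \<oplus>\<^bsub>?T\<^esub> ?l w' (tensor K U V u v)"
      using that by (simp add: l(2) VW.tensor_add_right R.tensor_add_right VW.tensor_closed)
  qed (use that in auto)
  have smult: "?l (a \<odot>\<^bsub>W\<^esub> w) t = a \<odot>\<^bsub>?T\<^esub> ?l w t"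
    if "a \<in> carrier K" "w \<in> carrier W" "t \<in> carrier (tensor_product K U V)" for a w t
  proof (rule UV.module_hom_eqI[OF R.T_module l(1) module_hom_smult[OF UV.T_module R.T_module that(1) l(1)] _ that(3)])
    fix u v assume "u \<in> carrier U" "v \<in> carrier V"
    then show "?l (a \<odot>\<^bsub>W\<^esub> w) (tensor K U V u v) = a \<odot>\<^bsub>?T\<^esub> ?l w (tensor K U V u v)"
      using that
      by (simp add: l(2) VW.smult_tensor_right[symmetric] R.smult_tensor_right VW.tensor_closed)
  qed (use that in auto)
  have "bilinear_map K (tensor_product K U V) W ?T (\<lambda>t w. ?l w t)"
    using l(1) add smult unfolding bilinear_map_def LinearCombinations.module_hom_def
    by (auto simp: Pi_iff)
  note * = L.tensor_lift[OF R.T_module this]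
  have eq: "tensor_assoc K U V W
      = tensor_lift K (tensor_product K U V) W ?T (\<lambda>t w. ?l w t)"
    by (simp only: tensor_assoc_def Let_def)
  show "tensor_assoc K U V W \<in> LinearCombinations.module_hom K
      (tensor_product K (tensor_product K U V) W) (tensor_product K U (tensor_product K V W))"
    unfolding eq by (rule *(1))
  show "\<And>u v w. u \<in> carrier U \<Longrightarrow> v \<in> carrier V \<Longrightarrow> w \<in> carrier W \<Longrightarrow>
      tensor_assoc K U V W (tensor K (tensor_product K U V) W (tensor K U V u v) w)
        = tensor K U (tensor_product K V W) u (tensor K V W v w)"
    unfolding eq using * l(2) UV.tensor_closed by simp
qed

end

theory Submission
  imports Defs
begin

text \<open>For linear maps \<open>f, g : C \<rightarrow> C \<otimes> C\<close> consider the relation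
  \<open>(f \<otimes> id) g = (id \<otimes> g) f\<close>.  Both sides are bilinear in the pair \<open>(f, g)\<close>: post-composition with
  the associativity isomorphism, with \<open>f \<otimes> id\<close> and with \<open>id \<otimes> g\<close> is linear, and
  \<open>f \<mapsto> f \<otimes> id\<close> and \<open>g \<mapsto> id \<otimes> g\<close> are themselves linear
  (\<open>tensor_map_lincomb_left\<close>, \<open>tensor_map_lincomb_right\<close>).  Hence the relation survives linear
  combinations in \<open>f\<close> with \<open>g\<close> fixed (\<open>coassociates_lincomb_left\<close>) and in \<open>g\<close> with \<open>f\<close> fixed
  (\<open>coassociates_lincomb_right\<close>).  The hypothesis gives it for every pair \<open>(\<Delta>\<^sub>p, \<Delta>\<^sub>q)\<close>; combining
  over \<open>p\<close> with the coefficients in row \<open>i\<close> of \<open>Z\<close> gives it for \<open>(\<Delta>'\<^sub>i, \<Delta>\<^sub>q)\<close>, and then combining over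
  \<open>q\<close> with row \<open>j\<close> gives it for \<open>(\<Delta>'\<^sub>i, \<Delta>'\<^sub>j)\<close>.  Treating the two arguments one after the other
  keeps every sum single.\<close>

section \<open>Linear combinations of module homomorphisms\<close>

lemma module_hom_mem:
  "h \<in> LinearCombinations.module_hom K M N \<Longrightarrow> x \<in> carrier M \<Longrightarrow> h x \<in> carrier N"
  by (auto simp: LinearCombinations.module_hom_def)

lemma module_hom_lincomb:
  assumes M: "Module.module K M" and N: "Module.module K N"
    and h: "h \<in> LinearCombinations.module_hom K M N"
    and a: "\<And>i. i \<in> I \<Longrightarrow> a i \<in> carrier K" and x: "\<And>i. i \<in> I \<Longrightarrow> x i \<in> carrier M"
  shows "h (\<Oplus>\<^bsub>M\<^esub>i\<in>I. a i \<odot>\<^bsub>M\<^esub> x i) = (\<Oplus>\<^bsub>N\<^esub>i\<in>I. a i \<odot>\<^bsub>N\<^esub> h (x i))"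
proof -
  interpret mod_hom K M N h
    using M N h by (simp add: mod_hom_def mod_hom_axioms_def)
  show ?thesis using a x
    by (induction I rule: infinite_finite_induct) (simp_all add: Pi_iff)
qed

text \<open>Homomorphisms are unrestricted functions of which only the values on the carrier matter, so a
  map that is prescribed on the carrier alone has to inherit linearity through the following lemma.\<close>

lemma module_hom_cong_carrier:
  assumes M: "Module.module K M" and f: "f \<in> LinearCombinations.module_hom K M N"
    and eq: "\<And>v. v \<in> carrier M \<Longrightarrow> g v = f v"
  shows "g \<in> LinearCombinations.module_hom K M N"
proof -
  interpret Module.module K M by (rule M)
  show ?thesis using f eq by (auto simp: LinearCombinations.module_hom_def Pi_iff)
qed

lemma lincomb_module_hom:
  assumes M: "Module.module K M" and N: "Module.module K N"
    and a: "\<And>i. i \<in> I \<Longrightarrow> a i \<in> carrier K"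
    and f: "\<And>i. i \<in> I \<Longrightarrow> f i \<in> LinearCombinations.module_hom K M N"
  shows "(\<lambda>v. \<Oplus>\<^bsub>N\<^esub>i\<in>I. a i \<odot>\<^bsub>N\<^esub> f i v) \<in> LinearCombinations.module_hom K M N"
proof -
  interpret M: Module.module K M by (rule M)
  interpret N: Module.module K N by (rule N)
  have zero: "(\<lambda>v. \<zero>\<^bsub>N\<^esub>) \<in> LinearCombinations.module_hom K M N"
    by (simp add: LinearCombinations.module_hom_def)
  have closed: "f i v \<in> carrier N" if "i \<in> I" "v \<in> carrier M" for i v
    using module_hom_mem[OF f[OF that(1)] that(2)] .
  show ?thesis using a f closed
  proof (induction I rule: infinite_finite_induct)
    case (insert i I)
    have "(\<lambda>v. a i \<odot>\<^bsub>N\<^esub> f i v \<oplus>\<^bsub>N\<^esub> (\<Oplus>\<^bsub>N\<^esub>i\<in>I. a i \<odot>\<^bsub>N\<^esub> f i v))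
        \<in> LinearCombinations.module_hom K M N"
      using insert by (intro module_hom_add module_hom_smult M N) auto
    moreover have "(\<Oplus>\<^bsub>N\<^esub>i\<in>insert i I. a i \<odot>\<^bsub>N\<^esub> f i v)
        = a i \<odot>\<^bsub>N\<^esub> f i v \<oplus>\<^bsub>N\<^esub> (\<Oplus>\<^bsub>N\<^esub>i\<in>I. a i \<odot>\<^bsub>N\<^esub> f i v)" if "v \<in> carrier M" for v
      using insert that by (intro N.finsum_insert) (auto simp: Pi_iff)
    ultimately show ?case
      by (rule module_hom_cong_carrier[OF M])
  qed (simp_all add: zero)
qed

section \<open>Linearity of the tensor product of maps\<close>

text \<open>Both sides are linear in \<open>X\<close>, so it suffices to compare them on pure tensors, where the claim
  is the linearity of \<open>\<otimes>\<close> in its first argument.\<close>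

lemma tensor_map_lincomb_left:
  assumes V: "Module.module K V" and W: "Module.module K W"
    and V': "Module.module K V'" and W': "Module.module K W'"
    and a: "\<And>i. i \<in> I \<Longrightarrow> a i \<in> carrier K"
    and f: "\<And>i. i \<in> I \<Longrightarrow> f i \<in> LinearCombinations.module_hom K V V'"
    and g: "g \<in> LinearCombinations.module_hom K W W'"
    and f': "\<And>v. v \<in> carrier V \<Longrightarrow> f' v = (\<Oplus>\<^bsub>V'\<^esub>i\<in>I. a i \<odot>\<^bsub>V'\<^esub> f i v)"
    and X: "X \<in> carrier (tensor_product K V W)"
  shows "tensor_map K V W V' W' f' g X
    = (\<Oplus>\<^bsub>tensor_product K V' W'\<^esub>i\<in>I. a i \<odot>\<^bsub>tensor_product K V' W'\<^esub>
        tensor_map K V W V' W' (f i) g X)"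
proof -
  interpret VW: module_pair K V W using V W by (simp add: module_pair_def)
  interpret VW': module_pair K V' W' using V' W' by (simp add: module_pair_def)
  have f'_hom: "f' \<in> LinearCombinations.module_hom K V V'"
    using lincomb_module_hom[OF V V' a f] f' by (rule module_hom_cong_carrier[OF V])
  interpret T': Module.module K VW'.T by (rule VW'.T_module)
  note maps = tensor_map[OF V W V' W' _ g]
  show ?thesis
  proof (rule VW.module_hom_eqI[OF VW'.T_module maps(1)[OF f'_hom]
        lincomb_module_hom[OF VW.T_module VW'.T_module a maps(1)[OF f]] _ X])
    fix v w assume vw: "v \<in> carrier V" "w \<in> carrier W"
    have "(\<lambda>v'. tensor K V' W' v' (g w)) \<in> LinearCombinations.module_hom K V' VW'.T"
      using VW'.tensor_bilinear module_hom_mem[OF g vw(2)] unfolding bilinear_map_def by blast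
    then have "tensor K V' W' (\<Oplus>\<^bsub>V'\<^esub>i\<in>I. a i \<odot>\<^bsub>V'\<^esub> f i v) (g w)
        = (\<Oplus>\<^bsub>VW'.T\<^esub>i\<in>I. a i \<odot>\<^bsub>VW'.T\<^esub> tensor K V' W' (f i v) (g w))"
      using f vw(1)
      by (intro module_hom_lincomb[OF V' VW'.T_module _ a])
         (auto intro: module_hom_mem)
    also have "\<dots> = (\<Oplus>\<^bsub>VW'.T\<^esub>i\<in>I. a i \<odot>\<^bsub>VW'.T\<^esub>
        tensor_map K V W V' W' (f i) g (tensor K V W v w))"
      by (intro T'.finsum_cong')
         (use a module_hom_mem[OF f vw(1)] module_hom_mem[OF g vw(2)] in
           \<open>auto simp: maps(2)[OF f vw] intro!: T'.smult_closed VW'.tensor_closed\<close>)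
    finally show "tensor_map K V W V' W' f' g (tensor K V W v w)
        = (\<Oplus>\<^bsub>VW'.T\<^esub>i\<in>I. a i \<odot>\<^bsub>VW'.T\<^esub>
            tensor_map K V W V' W' (f i) g (tensor K V W v w))"
      by (simp add: maps(2)[OF f'_hom vw] f'[OF vw(1)])
  qed
qed

lemma tensor_map_lincomb_right:
  assumes V: "Module.module K V" and W: "Module.module K W"
    and V': "Module.module K V'" and W': "Module.module K W'"
    and a: "\<And>i. i \<in> I \<Longrightarrow> a i \<in> carrier K"
    and f: "f \<in> LinearCombinations.module_hom K V V'"
    and g: "\<And>i. i \<in> I \<Longrightarrow> g i \<in> LinearCombinations.module_hom K W W'"
    and g': "\<And>w. w \<in> carrier W \<Longrightarrow> g' w = (\<Oplus>\<^bsub>W'\<^esub>i\<in>I. a i \<odot>\<^bsub>W'\<^esub> g i w)"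
    and X: "X \<in> carrier (tensor_product K V W)"
  shows "tensor_map K V W V' W' f g' X
    = (\<Oplus>\<^bsub>tensor_product K V' W'\<^esub>i\<in>I. a i \<odot>\<^bsub>tensor_product K V' W'\<^esub>
        tensor_map K V W V' W' f (g i) X)"
proof -
  interpret VW: module_pair K V W using V W by (simp add: module_pair_def)
  interpret VW': module_pair K V' W' using V' W' by (simp add: module_pair_def)
  have g'_hom: "g' \<in> LinearCombinations.module_hom K W W'"
    using lincomb_module_hom[OF W W' a g] g' by (rule module_hom_cong_carrier[OF W])
  interpret T': Module.module K VW'.T by (rule VW'.T_module)
  note maps = tensor_map[OF V W V' W' f]
  show ?thesis
  proof (rule VW.module_hom_eqI[OF VW'.T_module maps(1)[OF g'_hom]
        lincomb_module_hom[OF VW.T_module VW'.T_module a maps(1)[OF g]] _ X])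
    fix v w assume vw: "v \<in> carrier V" "w \<in> carrier W"
    have "(\<lambda>w'. tensor K V' W' (f v) w') \<in> LinearCombinations.module_hom K W' VW'.T"
      using VW'.tensor_bilinear module_hom_mem[OF f vw(1)] unfolding bilinear_map_def by blast
    then have "tensor K V' W' (f v) (\<Oplus>\<^bsub>W'\<^esub>i\<in>I. a i \<odot>\<^bsub>W'\<^esub> g i w)
        = (\<Oplus>\<^bsub>VW'.T\<^esub>i\<in>I. a i \<odot>\<^bsub>VW'.T\<^esub> tensor K V' W' (f v) (g i w))"
      using g vw(2)
      by (intro module_hom_lincomb[OF W' VW'.T_module _ a])
         (auto intro: module_hom_mem)
    also have "\<dots> = (\<Oplus>\<^bsub>VW'.T\<^esub>i\<in>I. a i \<odot>\<^bsub>VW'.T\<^esub>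
        tensor_map K V W V' W' f (g i) (tensor K V W v w))"
      by (intro T'.finsum_cong')
         (use a module_hom_mem[OF f vw(1)] module_hom_mem[OF g vw(2)] in
           \<open>auto simp: maps(2)[OF g vw] intro!: T'.smult_closed VW'.tensor_closed\<close>)
    finally show "tensor_map K V W V' W' f g' (tensor K V W v w)
        = (\<Oplus>\<^bsub>VW'.T\<^esub>i\<in>I. a i \<odot>\<^bsub>VW'.T\<^esub>
            tensor_map K V W V' W' f (g i) (tensor K V W v w))"
      by (simp add: maps(2)[OF g'_hom vw] g'[OF vw(2)])
  qed
qed

section \<open>Coassociating pairs of maps\<close>

text \<open>The equation \<open>(f \<otimes> id) g = (id \<otimes> g) f\<close>, with \<open>(C \<otimes> C) \<otimes> C\<close> and \<open>C \<otimes> (C \<otimes> C)\<close> identified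
  by the associativity isomorphism.\<close>

definition coassociates ::
    "('k, 'r) ring_scheme \<Rightarrow> ('k, 'c, 'm) module_scheme
      \<Rightarrow> ('c \<Rightarrow> ('c \<times> 'c \<Rightarrow>\<^sub>0 int) set) \<Rightarrow> ('c \<Rightarrow> ('c \<times> 'c \<Rightarrow>\<^sub>0 int) set) \<Rightarrow> bool" where
  "coassociates K C f g \<longleftrightarrow> (\<forall>c\<in>carrier C.
     tensor_assoc K C C C (tensor_map K C C (tensor_product K C C) C f id (g c))
       = tensor_map K C C C (tensor_product K C C) id g (f c))"

lemma id_module_hom: "id \<in> LinearCombinations.module_hom K M M"
  by (simp add: LinearCombinations.module_hom_def)

text \<open>On the left the combination passes through \<open>f \<mapsto> f \<otimes> id\<close> and then through the associativity
  isomorphism; on the right it passes through the linear map \<open>id \<otimes> g\<close>.\<close>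

lemma coassociates_lincomb_left:
  assumes C: "Module.module K C"
    and a: "\<And>i. i \<in> I \<Longrightarrow> a i \<in> carrier K"
    and f: "\<And>i. i \<in> I \<Longrightarrow> f i \<in> LinearCombinations.module_hom K C (tensor_product K C C)"
    and g: "g \<in> LinearCombinations.module_hom K C (tensor_product K C C)"
    and f': "\<And>c. c \<in> carrier C \<Longrightarrow>
      f' c = (\<Oplus>\<^bsub>tensor_product K C C\<^esub>i\<in>I. a i \<odot>\<^bsub>tensor_product K C C\<^esub> f i c)"
    and coassoc: "\<And>i. i \<in> I \<Longrightarrow> coassociates K C (f i) g"
  shows "coassociates K C f' g"
  unfolding coassociates_def
proof
  fix c assume c: "c \<in> carrier C"
  interpret CC: module_pair K C C using C by (simp add: module_pair_def)
  interpret L: module_pair K CC.T C using C CC.T_module by (simp add: module_pair_def)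
  interpret R: module_pair K C CC.T using C CC.T_module by (simp add: module_pair_def)
  interpret RM: Module.module K R.T by (rule R.T_module)
  let ?l = "\<lambda>f. tensor_map K C C CC.T C f id" and ?r = "tensor_map K C C C CC.T id g"
  let ?assoc = "tensor_assoc K C C C"
  have gc: "g c \<in> carrier CC.T" and fc: "\<And>i. i \<in> I \<Longrightarrow> f i c \<in> carrier CC.T"
    using module_hom_mem[OF f c] module_hom_mem[OF g c] by auto
  have l_hom: "?l (f i) \<in> LinearCombinations.module_hom K CC.T L.T" if "i \<in> I" for i
    by (rule tensor_map_hom[OF C C CC.T_module C f[OF that] id_module_hom])
  have r_hom: "?r \<in> LinearCombinations.module_hom K CC.T R.T"
    by (rule tensor_map_hom[OF C C C CC.T_module id_module_hom g])
  have "?assoc (?l f' (g c)) = ?assoc (\<Oplus>\<^bsub>L.T\<^esub>i\<in>I. a i \<odot>\<^bsub>L.T\<^esub> ?l (f i) (g c))"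
    by (simp only: tensor_map_lincomb_left[OF C C CC.T_module C a f id_module_hom f' gc])
  also have "\<dots> = (\<Oplus>\<^bsub>R.T\<^esub>i\<in>I. a i \<odot>\<^bsub>R.T\<^esub> ?assoc (?l (f i) (g c)))"
    by (rule module_hom_lincomb[OF L.T_module R.T_module tensor_assoc_hom[OF C C C] a])
       (use module_hom_mem[OF l_hom] gc in auto)
  also have "\<dots> = (\<Oplus>\<^bsub>R.T\<^esub>i\<in>I. a i \<odot>\<^bsub>R.T\<^esub> ?r (f i c))"
    by (rule RM.finsum_cong')
       (use coassoc c a module_hom_mem[OF r_hom] fc in
         \<open>auto simp: coassociates_def intro!: RM.smult_closed\<close>)
  also have "\<dots> = ?r (\<Oplus>\<^bsub>CC.T\<^esub>i\<in>I. a i \<odot>\<^bsub>CC.T\<^esub> f i c)"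
    by (rule module_hom_lincomb[OF CC.T_module R.T_module r_hom a fc, symmetric])
  also have "\<dots> = ?r (f' c)" by (simp only: f'[OF c])
  finally show "?assoc (?l f' (g c)) = ?r (f' c)" .
qed

text \<open>Now the combination passes through the linear map \<open>f \<otimes> id\<close> and the associativity isomorphism
  on the left, and through \<open>g \<mapsto> id \<otimes> g\<close> on the right.\<close>

lemma coassociates_lincomb_right:
  assumes C: "Module.module K C"
    and a: "\<And>i. i \<in> I \<Longrightarrow> a i \<in> carrier K"
    and f: "f \<in> LinearCombinations.module_hom K C (tensor_product K C C)"
    and g: "\<And>i. i \<in> I \<Longrightarrow> g i \<in> LinearCombinations.module_hom K C (tensor_product K C C)"
    and g': "\<And>c. c \<in> carrier C \<Longrightarrow>
      g' c = (\<Oplus>\<^bsub>tensor_product K C C\<^esub>i\<in>I. a i \<odot>\<^bsub>tensor_product K C C\<^esub> g i c)"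
    and coassoc: "\<And>i. i \<in> I \<Longrightarrow> coassociates K C f (g i)"
  shows "coassociates K C f g'"
  unfolding coassociates_def
proof
  fix c assume c: "c \<in> carrier C"
  interpret CC: module_pair K C C using C by (simp add: module_pair_def)
  interpret L: module_pair K CC.T C using C CC.T_module by (simp add: module_pair_def)
  interpret R: module_pair K C CC.T using C CC.T_module by (simp add: module_pair_def)
  interpret RM: Module.module K R.T by (rule R.T_module)
  let ?l = "tensor_map K C C CC.T C f id" and ?r = "\<lambda>g. tensor_map K C C C CC.T id g"
  let ?assoc = "tensor_assoc K C C C"
  have fc: "f c \<in> carrier CC.T" and gc: "\<And>i. i \<in> I \<Longrightarrow> g i c \<in> carrier CC.T"
    using module_hom_mem[OF f c] module_hom_mem[OF g c] by auto
  have l_hom: "?l \<in> LinearCombinations.module_hom K CC.T L.T"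
    by (rule tensor_map_hom[OF C C CC.T_module C f id_module_hom])
  have r_hom: "?r (g i) \<in> LinearCombinations.module_hom K CC.T R.T" if "i \<in> I" for i
    by (rule tensor_map_hom[OF C C C CC.T_module id_module_hom g[OF that]])
  have "?assoc (?l (g' c)) = ?assoc (?l (\<Oplus>\<^bsub>CC.T\<^esub>i\<in>I. a i \<odot>\<^bsub>CC.T\<^esub> g i c))"
    by (simp only: g'[OF c])
  also have "\<dots> = ?assoc (\<Oplus>\<^bsub>L.T\<^esub>i\<in>I. a i \<odot>\<^bsub>L.T\<^esub> ?l (g i c))"
    by (simp only: module_hom_lincomb[OF CC.T_module L.T_module l_hom a gc])
  also have "\<dots> = (\<Oplus>\<^bsub>R.T\<^esub>i\<in>I. a i \<odot>\<^bsub>R.T\<^esub> ?assoc (?l (g i c)))"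
    by (rule module_hom_lincomb[OF L.T_module R.T_module tensor_assoc_hom[OF C C C] a])
       (use module_hom_mem[OF l_hom] gc in auto)
  also have "\<dots> = (\<Oplus>\<^bsub>R.T\<^esub>i\<in>I. a i \<odot>\<^bsub>R.T\<^esub> ?r (g i) (f c))"
    by (rule RM.finsum_cong')
       (use coassoc c a module_hom_mem[OF r_hom] fc in
         \<open>auto simp: coassociates_def intro!: RM.smult_closed\<close>)
  also have "\<dots> = ?r g' (f c)"
    by (rule tensor_map_lincomb_right[OF C C C CC.T_module a id_module_hom g g' fc, symmetric])
  finally show "?assoc (?l (g' c)) = ?r g' (f c)" .
qed

section \<open>Linear recombination of the comultiplications\<close>

theorem proposition4p4:
  fixes K :: "('k, 'r) ring_scheme"
    and C :: "('k, 'c, 'm) module_scheme"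
    and n :: nat
    and \<Delta> \<Delta>' :: "nat \<Rightarrow> 'c \<Rightarrow> ('c \<times> 'c \<Rightarrow>\<^sub>0 int) set"
    and Z :: "'k mat"
  assumes real_or_complex: "K \<simeq> (class_ring :: real ring) \<or> K \<simeq> (class_ring :: complex ring)"
    and vectorspace: "vectorspace K C"
    and linear: "\<And>i. i < n \<Longrightarrow> linear_map K C (tensor_product K C C) (\<Delta> i)"
    and coassoc: "\<And>i j c. i < n \<Longrightarrow> j < n \<Longrightarrow> c \<in> carrier C \<Longrightarrow>
      tensor_assoc K C C C (tensor_map K C C (tensor_product K C C) C (\<Delta> i) id (\<Delta> j c))
        = tensor_map K C C C (tensor_product K C C) id (\<Delta> j) (\<Delta> i c)"
    and Z: "Z \<in> carrier_mat n n" "elements_mat Z \<subseteq> carrier K"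
    and \<Delta>': "\<And>i c. i < n \<Longrightarrow> c \<in> carrier C \<Longrightarrow>
      \<Delta>' i c = (\<Oplus>\<^bsub>tensor_product K C C\<^esub> j \<in> {..<n}. Z $$ (i, j) \<odot>\<^bsub>tensor_product K C C\<^esub> \<Delta> j c)"
  shows "\<forall>i<n. \<forall>j<n. \<forall>c\<in>carrier C.
      tensor_assoc K C C C (tensor_map K C C (tensor_product K C C) C (\<Delta>' i) id (\<Delta>' j c))
        = tensor_map K C C C (tensor_product K C C) id (\<Delta>' j) (\<Delta>' i c)"
proof -
  interpret C: vectorspace K C by (rule vectorspace)
  have C: "Module.module K C" by (rule C.module_axioms)
  interpret CC: module_pair K C C using C by (simp add: module_pair_def)
  have hom: "\<Delta> i \<in> LinearCombinations.module_hom K C CC.T" if "i \<in> {..<n}" for i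
    using linear[of i] that by (simp add: linear_map_def mod_hom_def mod_hom_axioms_def)
  have Z_closed: "Z $$ (i, j) \<in> carrier K" if "i < n" "j \<in> {..<n}" for i j
    using Z that elements_matI[of Z n n i j] by auto
  have hom': "\<Delta>' i \<in> LinearCombinations.module_hom K C CC.T" if "i < n" for i
    using lincomb_module_hom[OF C CC.T_module Z_closed[OF that] hom] \<Delta>'[OF that]
    by (rule module_hom_cong_carrier[OF C])
  have left: "coassociates K C (\<Delta>' i) (\<Delta> q)" if "i < n" "q \<in> {..<n}" for i q
    using coassoc that
    by (intro coassociates_lincomb_left[OF C Z_closed[OF that(1)] hom hom[OF that(2)] \<Delta>'[OF that(1)]])
       (auto simp: coassociates_def)
  have "coassociates K C (\<Delta>' i) (\<Delta>' j)" if "i < n" "j < n" for i j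
    by (rule coassociates_lincomb_right[OF C Z_closed[OF that(2)] hom'[OF that(1)] hom
          \<Delta>'[OF that(2)] left[OF that(1)]])
  then show ?thesis by (simp add: coassociates_def)
qed

end
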